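(* Let $S\subseteq\{0,1\}^\omega$ be a set which is not of first category in the Cantor space $\{0,1\}^\omega$. Then for each function $f:\omega\to\bigcup_{n\in\omega}\{0,1\}^n$ there exists a sequence $\{a_n\}_{n\in\omega}$ belonging to $S$ such that for infinitely many $i\in\omega$ the infinite sequence $\{a_{i+n}\}_{n\in\omega}$ extends the finite sequence $f(i)$.
   Context: $\{0,1\}^\omega$ is the Cantor space (countable product of the discrete space $\{0,1\}$ with the product topology); $\{0,1\}^n$ is the set of finite binary sequences of length $n$. An infinite sequence $\{b_n\}_{n\in\omega}$ extends a finite sequence $(s_0,\dots,s_{m-1})$ if $b_j=s_j$ for all $j<m$. A set is of first category if it is a countable union of nowhere dense sets. *)

theory Defs
  imports "HOL-Analysis.Analysis"
begin

(* The Cantor space is the type nat => bool: bool carries the discrete topology (class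
   discrete_topology) and the function type the product topology of Function_Topology.
   A finite binary sequence is a bool list. *)
type_synonym cantor = "nat \<Rightarrow> bool"

definition nowhere_dense :: "'a::topological_space set \<Rightarrow> bool" where
  "nowhere_dense A \<longleftrightarrow> interior (closure A) = {}"

definition first_category :: "'a::topological_space set \<Rightarrow> bool" where
  "first_category S \<longleftrightarrow> (\<exists>\<N>. countable \<N> \<and> (\<forall>A\<in>\<N>. nowhere_dense A) \<and> S = \<Union>\<N>)"

definition extends :: "(nat \<Rightarrow> 'a) \<Rightarrow> 'a list \<Rightarrow> bool" where
  "extends b s \<longleftrightarrow> (\<forall>j<length s. b j = s ! j)"

end

(* The sequences a for which f i occurs at position i for no i >= n form a closed set. It has
   empty interior because, given a basic neighbourhood constraining only coordinates below N,
   one can write f i at a position i >= max n N. *)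
theory Submission
  imports Defs
begin

text \<open>Some basic open box around \<open>x\<close> lies inside \<open>U\<close> and restricts
  only finitely many coordinates, so any \<open>N\<close> exceeding all of these indices
  works.\<close>

lemma open_fun_determined_by_prefix:
  fixes U :: "(nat \<Rightarrow> 'a::topological_space) set"
  assumes "open U" "x \<in> U"
  obtains N where "\<And>y. (\<And>k. k < N \<Longrightarrow> y k = x k) \<Longrightarrow> y \<in> U"
proof -
  have "openin (product_topology (\<lambda>_. euclidean) UNIV) U"
    using assms(1) by (simp add: open_fun_def)
  from product_topology_open_contains_basis[OF this assms(2)]
  obtain X where X: "x \<in> Pi\<^sub>E UNIV X" "finite {i. X i \<noteq> UNIV}" "Pi\<^sub>E UNIV X \<subseteq> U"
    by (auto simp: topspace_euclidean)
  obtain N where N: "\<And>i. X i \<noteq> UNIV \<Longrightarrow> i < N"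
    using X(2) by (auto simp: finite_nat_set_iff_bounded)
  have "y \<in> U" if "\<And>k. k < N \<Longrightarrow> y k = x k" for y
  proof -
    have "y i \<in> X i" for i
      \<comment> \<open>An unrestricted coordinate imposes nothing; a restricted one has
        \<open>i < N\<close>, so there \<open>y i = x i\<close>.\<close>
      using X(1) N[of i] that[of i] by (cases "X i = UNIV") (auto simp: PiE_iff)
    then show ?thesis
      using X(3) by (auto simp: PiE_iff)
  qed
  then show thesis
    by (rule that)
qed

text \<open>Points are open in a discrete space, so prescribing finitely many coordinates is a
  finite intersection of open preimages under projections.\<close>

lemma open_extends_shift:
  fixes s :: "'a::discrete_topology list"
  shows "open {a. extends (\<lambda>n. a (i + n)) s}"
proof -
  have "open ((\<lambda>a :: nat \<Rightarrow> 'a. a k) -` {c})" for k c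
    by (intro open_vimage open_discrete continuous_on_product_coordinates)
  then have "open (\<Inter>j\<in>{..<length s}. (\<lambda>a. a (i + j)) -` {s ! j})"
    by auto
  also have "\<dots> = {a. extends (\<lambda>n. a (i + n)) s}"
    by (auto simp: extends_def)
  finally show ?thesis .
qed

lemma nowhere_dense_never_extends_from:
  fixes f :: "nat \<Rightarrow> 'a::discrete_topology list"
  shows "nowhere_dense {a. \<forall>i\<ge>n. \<not> extends (\<lambda>k. a (i + k)) (f i)}" (is "nowhere_dense ?A")
proof -
  have "?A = - (\<Union>i\<in>{n..}. {a. extends (\<lambda>k. a (i + k)) (f i)})"
    by auto
  then have "closed ?A"
    by (auto simp: open_extends_shift intro!: closed_Compl)
  moreover have "interior ?A = {}"
  proof (rule ccontr)
    assume "interior ?A \<noteq> {}"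
    then obtain x where x: "x \<in> interior ?A"
      by blast
    obtain N where N: "\<And>y. (\<And>k. k < N \<Longrightarrow> y k = x k) \<Longrightarrow> y \<in> interior ?A"
      using open_fun_determined_by_prefix[OF open_interior x] by blast
    \<comment> \<open>The bound \<open>N\<close> keeps \<open>y\<close> equal to \<open>x\<close> on
      the constrained prefix, while \<open>n\<close> makes the occurrence at \<open>i\<close>
      contradict \<open>y \<in> ?A\<close>. Past the end of \<open>f i\<close>, the values of
      \<open>y\<close> are unspecified, which is harmless since \<open>extends\<close> inspects only
      indices below the length.\<close>
    define i where "i = max n N"
    define y where "y k = (if k < i then x k else f i ! (k - i))" for k
    have "y \<in> ?A"
    proof (rule subsetD[OF interior_subset N])
      show "y k = x k" if "k < N" for k
        using that by (simp add: y_def i_def less_max_iff_disj)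
    qed
    moreover have "extends (\<lambda>k. y (i + k)) (f i)"
      by (simp add: extends_def y_def)
    ultimately show False
      by (auto simp: i_def)
  qed
  ultimately show ?thesis
    by (simp add: nowhere_dense_def)
qed

lemma nowhere_dense_subset:
  assumes "nowhere_dense B" "A \<subseteq> B"
  shows "nowhere_dense A"
  using assms interior_mono[OF closure_mono[OF assms(2)]] by (auto simp: nowhere_dense_def)

theorem theorem1:
  fixes S :: "cantor set" and f :: "nat \<Rightarrow> bool list"
  assumes "\<not> first_category S"
  shows "\<exists>a\<in>S. infinite {i. extends (\<lambda>n. a (i + n)) (f i)}"
proof (rule ccontr)
  assume "\<not> ?thesis"
  then have fin: "finite {i. extends (\<lambda>n. a (i + n)) (f i)}" if "a \<in> S" for a
    using that by blast
  define A where "A n = {a. \<forall>i\<ge>n. \<not> extends (\<lambda>k. a (i + k)) (f i)}" for n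
  \<comment> \<open>A finite set of positions has a strict upper bound, which serves as
    \<open>n\<close>.\<close>
  have "\<exists>n. a \<in> A n" if "a \<in> S" for a
    using fin[OF that] by (auto simp: A_def finite_nat_set_iff_bounded not_less[symmetric])
  \<comment> \<open>Each \<open>A n\<close> is cut down to \<open>S\<close> because
    \<open>first_category\<close> asks for equality with the union, not mere inclusion.\<close>
  then have "S = \<Union> (range (\<lambda>n. S \<inter> A n))"
    by blast
  moreover have "nowhere_dense (S \<inter> A n)" for n
    using nowhere_dense_never_extends_from[of n f] nowhere_dense_subset[of "A n" "S \<inter> A n"]
    by (simp add: A_def)
  ultimately have "first_category S"
    unfolding first_category_def by (intro exI[of _ "range (\<lambda>n. S \<inter> A n)"]) auto
  with assms show False ..
qed

end
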